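(* Let $\hbar>0$, $q=e^{i\pi\hbar}$, let $\omega_0,\omega_1,\omega_2$ be real parameters, and let $a_i,b_i,c_i$ ($i=1,2$), $K_1,K_2$ be the quantum monodromy entries and central elements of the four-holed sphere (P$_{VI}$) system defined in the context. Put $\omega_3=K_1+K_2$ and define the geodesic functions \begin{align*} G_{XZ}&=c_1+b_1+\omega_0a_1,\\ G_{XY}&=c_2+b_2+\omega_0a_2,\\ G_{YZ}&=qb_1c_2-q^3a_1a_2-q^2(\omega_1a_2+\omega_2a_1)-q\omega_1\omega_2 . \end{align*} Then \begin{align*} qG_{XY}G_{XZ}-q^{-1}G_{XZ}G_{XY}&=(q^2-q^{-2})G_{YZ}+(q-q^{-1})(\omega_1\omega_2+\omega_0\omega_3),\\ qG_{XZ}G_{YZ}-q^{-1}G_{YZ}G_{XZ}&=(q^2-q^{-2})G_{XY}+(q-q^{-1})(\omega_2\omega_0+\omega_1\omega_3),\\ qG_{YZ}G_{XY}-q^{-1}G_{XY}G_{YZ}&=(q^2-q^{-2})G_{XZ}+(q-q^{-1})(\omega_0\omega_1+\omega_2\omega_3). \end{align*}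
   Context: Let $X,Y,Z$ be self-adjoint operators with scalar commutators $[X,Y]=[Y,Z]=[Z,X]=2\pi i\hbar$; exponentials of their linear combinations multiply by $e^Ue^V=e^{\frac12[U,V]}e^{U+V}$. The entries are $$a_1=e^{-Z},\quad b_1=e^{X-Z}+e^{X+Z}+\omega_1e^X,\quad c_1=e^{-X-Z},$$ $$a_2=e^{Y},\quad b_2=e^{X+Y},\quad c_2=e^{-X-Y}+e^{-X+Y}+\omega_2e^{-X},$$ which are the entries of the monodromy matrices $M_i=\begin{pmatrix}qa_i+\omega_i&-b_i\\c_i&-q^{-1}a_i\end{pmatrix}$, and $$K_1=a_1c_2-q^2c_1a_2-q\omega_2c_1,\qquad K_2=a_2b_1-q^{-2}b_2a_1-q^{-1}\omega_1b_2 ,$$ which commute with all $a_i,b_i,c_i$. *)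

theory Defs
  imports "HOL-Analysis.Analysis" "HOL-Library.Function_Algebras"
begin

section \<open>Complex Hilbert spaces\<close>

text \<open>The inner product is linear in the second argument.\<close>

class complex_hilbert = real_inner + complete_space +
  fixes scaleC :: "complex \<Rightarrow> 'a \<Rightarrow> 'a" (infixr "*\<^sub>C" 75)
    and cinner :: "'a \<Rightarrow> 'a \<Rightarrow> complex"
  assumes scaleC_add_right: "c *\<^sub>C (x + y) = c *\<^sub>C x + c *\<^sub>C y"
    and scaleC_add_left: "(c + d) *\<^sub>C x = c *\<^sub>C x + d *\<^sub>C x"
    and scaleC_scaleC: "c *\<^sub>C (d *\<^sub>C x) = (c * d) *\<^sub>C x"
    and scaleC_of_real: "complex_of_real r *\<^sub>C x = r *\<^sub>R x"
    and cinner_commute: "cinner x y = cnj (cinner y x)"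
    and cinner_add_right: "cinner x (y + z) = cinner x y + cinner x z"
    and cinner_scaleC_right: "cinner x (c *\<^sub>C y) = c * cinner x y"
    and inner_eq_Re_cinner: "inner x y = Re (cinner x y)"

definition csubspace :: "'h::complex_hilbert set \<Rightarrow> bool" where
  "csubspace S \<longleftrightarrow> 0 \<in> S \<and> (\<forall>x\<in>S. \<forall>y\<in>S. x + y \<in> S) \<and> (\<forall>c. \<forall>x\<in>S. c *\<^sub>C x \<in> S)"


section \<open>Unbounded self-adjoint operators\<close>

text \<open>An unbounded operator is represented by its graph; its domain is the \<^const>\<open>Domain\<close>
  of the graph.\<close>

definition adjoint_op :: "'h::complex_hilbert rel \<Rightarrow> 'h rel" where
  "adjoint_op A = {(y, z). \<forall>(x, w)\<in>A. cinner w y = cinner x z}"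

text \<open>Since the adjoint of a densely defined relation is a single-valued linear relation,
  the following condition entails that \<open>A\<close> is the graph of a linear operator.\<close>

definition selfadjoint_op :: "'h::complex_hilbert rel \<Rightarrow> bool" where
  "selfadjoint_op A \<longleftrightarrow> closure (Domain A) = UNIV \<and> adjoint_op A = A"

text \<open>The value \<open>A\<langle>x\<rangle>\<close> is meaningful only for \<open>x\<close> in the domain of a single-valued \<open>A\<close>.\<close>

definition op_app :: "'h rel \<Rightarrow> 'h \<Rightarrow> 'h" ("_\<langle>_\<rangle>" [1000, 0] 1000) where
  "A\<langle>x\<rangle> = (THE y. (x, y) \<in> A)"

definition maps_into :: "'h rel \<Rightarrow> 'h set \<Rightarrow> bool" where
  "maps_into A D \<longleftrightarrow> (\<forall>x\<in>D. \<exists>y\<in>D. (x, y) \<in> A)"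


section \<open>The exponential of a self-adjoint operator\<close>

text \<open>Spectral families: \<open>E t\<close> is the spectral projection of the half-line \<open>{..t}\<close>.\<close>

definition resolution_of_identity :: "(real \<Rightarrow> 'h::complex_hilbert \<Rightarrow> 'h) \<Rightarrow> bool" where
  "resolution_of_identity E \<longleftrightarrow>
     (\<forall>t x y. E t (x + y) = E t x + E t y) \<and>
     (\<forall>t c x. E t (c *\<^sub>C x) = c *\<^sub>C E t x) \<and>
     (\<forall>t x y. cinner (E t x) y = cinner x (E t y)) \<and>
     (\<forall>s t x. s \<le> t \<longrightarrow> E s (E t x) = E s x) \<and>
     (\<forall>t x. ((\<lambda>s. E s x) \<longlongrightarrow> E t x) (at_right t)) \<and>
     (\<forall>x. ((\<lambda>s. E s x) \<longlongrightarrow> 0) at_bot) \<and>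
     (\<forall>x. ((\<lambda>s. E s x) \<longlongrightarrow> x) at_top)"

text \<open>Riemann--Stieltjes sum with mesh \<open>1 / (m + 1)\<close> for the integral of \<open>f\<close> over \<open>(-n, n]\<close>
  against \<open>dE x\<close>.\<close>

definition stieltjes_sum ::
    "(real \<Rightarrow> 'h::complex_hilbert \<Rightarrow> 'h) \<Rightarrow> (real \<Rightarrow> real) \<Rightarrow> nat \<Rightarrow> nat \<Rightarrow> 'h \<Rightarrow> 'h" where
  "stieltjes_sum E f n m x =
     (\<Sum>k\<in>{- (int n * int (Suc m)) ..< int n * int (Suc m)}.
        f (of_int k / Suc m) *\<^sub>R (E (of_int (k + 1) / Suc m) x - E (of_int k / Suc m) x))"

text \<open>The operator \<open>\<integral> f dE\<close> for continuous \<open>f\<close>, as the strong limit of its truncations to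
  \<open>(-n, n]\<close>. The limit exists exactly for those \<open>x\<close> for which \<open>f\<^sup>2\<close> is integrable against
  \<open>d\<parallel>E x\<parallel>\<^sup>2\<close>, so this is the usual domain.\<close>

definition spectral_integral ::
    "(real \<Rightarrow> 'h::complex_hilbert \<Rightarrow> 'h) \<Rightarrow> (real \<Rightarrow> real) \<Rightarrow> 'h rel" where
  "spectral_integral E f =
     {(x, y). \<exists>v. (\<forall>n. (\<lambda>m. stieltjes_sum E f n m x) \<longlonglongrightarrow> v n) \<and> v \<longlonglongrightarrow> y}"

text \<open>\<open>A = e\<^sup>U\<close> in the sense of the functional calculus. By the spectral theorem every
  self-adjoint \<open>U\<close> has exactly one such \<open>A\<close>.\<close>

definition is_exponential :: "'h::complex_hilbert rel \<Rightarrow> 'h rel \<Rightarrow> bool" where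
  "is_exponential U A \<longleftrightarrow>
     (\<exists>E. resolution_of_identity E \<and> U = spectral_integral E (\<lambda>t. t) \<and> A = spectral_integral E exp)"


section \<open>Three self-adjoint operators with scalar commutators\<close>

text \<open>The operators and their exponentials are unbounded, so identities between sums and products
  of them are understood on a common dense invariant domain \<open>D\<close>. The linear combination
  \<open>x X + y Y + z Z\<close> denotes the closure of the operator defined on \<open>D\<close>.\<close>

definition lin_comb :: "'h::complex_hilbert rel \<Rightarrow> 'h rel \<Rightarrow> 'h rel \<Rightarrow> 'h set \<Rightarrow>
    real \<Rightarrow> real \<Rightarrow> real \<Rightarrow> 'h rel" where
  "lin_comb X Y Z D x y z =
     closure {(\<phi>, x *\<^sub>R X\<langle>\<phi>\<rangle> + y *\<^sub>R Y\<langle>\<phi>\<rangle> + z *\<^sub>R Z\<langle>\<phi>\<rangle>) | \<phi>. \<phi> \<in> D}"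

definition scalar_commutator :: "'h::complex_hilbert set \<Rightarrow> 'h rel \<Rightarrow> 'h rel \<Rightarrow> complex \<Rightarrow> bool" where
  "scalar_commutator D U V c \<longleftrightarrow> (\<forall>\<phi>\<in>D. U\<langle>V\<langle>\<phi>\<rangle>\<rangle> - V\<langle>U\<langle>\<phi>\<rangle>\<rangle> = c *\<^sub>C \<phi>)"

text \<open>\<open>ex x y z\<close> is the exponential of \<open>x X + y Y + z Z\<close>.\<close>

locale exponentiated_triple =
  fixes hbar :: real
    and X Y Z :: "'h::complex_hilbert rel"
    and D :: "'h set"
    and ex :: "real \<Rightarrow> real \<Rightarrow> real \<Rightarrow> 'h rel"
  assumes selfadjoint: "selfadjoint_op X" "selfadjoint_op Y" "selfadjoint_op Z"
    and domain: "csubspace D" "closure D = UNIV"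
    and invariant: "maps_into X D" "maps_into Y D" "maps_into Z D"
    and commutators:
      "scalar_commutator D X Y (2 * pi * \<i> * hbar)"
      "scalar_commutator D Y Z (2 * pi * \<i> * hbar)"
      "scalar_commutator D Z X (2 * pi * \<i> * hbar)"
    and selfadjoint_lin_comb: "selfadjoint_op (lin_comb X Y Z D x y z)"
    and exponential: "is_exponential (lin_comb X Y Z D x y z) (ex x y z)"
    and invariant_exponential: "maps_into (ex x y z) D"
    and exponential_product:
      "scalar_commutator D (lin_comb X Y Z D x y z) (lin_comb X Y Z D x' y' z') c \<Longrightarrow> \<phi> \<in> D \<Longrightarrow>
         (ex x y z)\<langle>(ex x' y' z')\<langle>\<phi>\<rangle>\<rangle> = exp (c / 2) *\<^sub>C (ex (x + x') (y + y') (z + z'))\<langle>\<phi>\<rangle>"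


section \<open>Algebra of operators\<close>

text \<open>Sums and differences of operators are the pointwise ones of
  \<^theory>\<open>HOL-Library.Function_Algebras\<close>; the pointwise product of that theory is not used.\<close>

definition op_scale :: "complex \<Rightarrow> ('h \<Rightarrow> 'h) \<Rightarrow> 'h::complex_hilbert \<Rightarrow> 'h" (infixr "\<odot>" 75) where
  "c \<odot> A = (\<lambda>\<phi>. c *\<^sub>C A \<phi>)"

abbreviation op_mult :: "('h \<Rightarrow> 'h) \<Rightarrow> ('h \<Rightarrow> 'h) \<Rightarrow> 'h \<Rightarrow> 'h" (infixl "\<star>" 76) where
  "A \<star> B \<equiv> A \<circ> B"

end

(*
  On D the operators W(u) = exp(u_1 X + u_2 Y + u_3 Z) satisfy the Weyl relations
  W(u) W(v) = q^sigma(u,v) W(u+v), where sigma is the bilinear form given by the commutators. In this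
  quantum torus each geodesic function is a combination of five W(u), and
  q W(u) W(v) - q^-1 W(v) W(u) = (q^(1+sigma) - q^-(1+sigma)) W(u+v), so the relations can be compared
  coefficient by coefficient. The analytic input is that W(u) is linear on D and that W(0) = 1: the
  Weyl relations make W(0) idempotent, and it is injective because its kernel vectors x satisfy
  0 >= e^-N <x, (E(N) - E(-N)) x> for every N.
*)
theory Submission
  imports Defs
begin

section \<open>Complex scalars, the inner product and the norm\<close>

lemma scaleC_zero_left [simp]: "0 *\<^sub>C x = 0" for x :: "'h::complex_hilbert"
  using scaleC_of_real[of 0 x] by simp

lemma scaleC_one [simp]: "1 *\<^sub>C x = x" for x :: "'h::complex_hilbert"
  using scaleC_of_real[of 1 x] by simp

lemma scaleC_minus_one: "(-1) *\<^sub>C x = - x" for x :: "'h::complex_hilbert"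
  using scaleC_of_real[of "-1" x] by simp

lemma scaleC_zero_right [simp]: "c *\<^sub>C 0 = (0 :: 'h::complex_hilbert)"
  using scaleC_add_right[of c "0 :: 'h" 0] by simp

lemma scaleC_minus_left: "(- c) *\<^sub>C x = - (c *\<^sub>C x)" for x :: "'h::complex_hilbert"
  using scaleC_scaleC[of "-1" c x] by (simp add: scaleC_minus_one)

lemma scaleC_minus_right: "c *\<^sub>C (- x) = - (c *\<^sub>C x)" for x :: "'h::complex_hilbert"
  using scaleC_scaleC[of c "-1" x] by (simp add: scaleC_minus_one scaleC_minus_left)

lemma scaleC_diff_left: "(c - d) *\<^sub>C x = c *\<^sub>C x - d *\<^sub>C x" for x :: "'h::complex_hilbert"
  using scaleC_add_left[of c "- d" x] by (simp add: scaleC_minus_left)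

lemma scaleC_diff_right: "c *\<^sub>C (x - y) = c *\<^sub>C x - c *\<^sub>C y" for x :: "'h::complex_hilbert"
  using scaleC_add_right[of c x "- y"] by (simp add: scaleC_minus_right)

lemma scaleC_sum_right: "c *\<^sub>C (\<Sum>k\<in>A. f k) = (\<Sum>k\<in>A. c *\<^sub>C f k)" for f :: "_ \<Rightarrow> 'h::complex_hilbert"
  by (induction A rule: infinite_finite_induct) (auto simp: scaleC_add_right)

lemma cinner_add_left: "cinner (x + y) z = cinner x z + cinner y z" for x :: "'h::complex_hilbert"
  using cinner_commute[of "x + y" z] cinner_commute[of x z] cinner_commute[of y z]
  by (simp add: cinner_add_right)

lemma cinner_scaleC_left: "cinner (c *\<^sub>C x) y = cnj c * cinner x y" for x :: "'h::complex_hilbert"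
  using cinner_commute[of "c *\<^sub>C x" y] cinner_commute[of x y] by (simp add: cinner_scaleC_right)

text \<open>Sesquilinearity of \<open>cinner\<close> produces the factor \<open>c * cnj c\<close> in
  the squared norm. Continuity of complex scaling rests on this.\<close>

lemma norm_scaleC: "norm (c *\<^sub>C x) = cmod c * norm x" for x :: "'h::complex_hilbert"
proof -
  have "inner (c *\<^sub>C x) (c *\<^sub>C x) = Re ((c * cnj c) * cinner x x)"
    by (simp add: inner_eq_Re_cinner cinner_scaleC_left cinner_scaleC_right mult_ac)
  also have "\<dots> = (cmod c)\<^sup>2 * inner x x"
    by (simp add: complex_norm_square [symmetric] inner_eq_Re_cinner)
  also have "\<dots> = (cmod c * norm x)\<^sup>2"
    by (simp add: power_mult_distrib power2_norm_eq_inner)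
  finally have "(norm (c *\<^sub>C x))\<^sup>2 = (cmod c * norm x)\<^sup>2"
    by (simp add: power2_norm_eq_inner)
  then show ?thesis by (simp add: power2_eq_iff_nonneg)
qed

lemma tendsto_scaleC:
  fixes f :: "'b \<Rightarrow> 'h::complex_hilbert"
  assumes "(f \<longlongrightarrow> l) F"
  shows "((\<lambda>t. c *\<^sub>C f t) \<longlongrightarrow> c *\<^sub>C l) F"
proof -
  have "((\<lambda>t. cmod c * norm (f t - l)) \<longlongrightarrow> cmod c * 0) F"
    using assms by (intro tendsto_mult_left) (simp add: LIM_zero_iff tendsto_norm_zero)
  then have "((\<lambda>t. norm (c *\<^sub>C f t - c *\<^sub>C l)) \<longlongrightarrow> 0) F"
    by (simp add: norm_scaleC flip: scaleC_diff_right)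
  then show ?thesis
    by (simp add: LIM_zero_iff tendsto_norm_zero_iff)
qed

section \<open>Self-adjoint operators\<close>

text \<open>An adjoint is a linear relation whatever \<open>A\<close> is, so the equation
  \<open>adjoint_op A = A\<close> makes a self-adjoint \<open>A\<close> linear.\<close>

lemma adjoint_op_add:
  assumes "(x, y) \<in> adjoint_op A" "(x', y') \<in> adjoint_op A"
  shows "(x + x', y + y') \<in> adjoint_op A"
  using assms by (fastforce simp: adjoint_op_def cinner_add_right)

lemma adjoint_op_scaleR:
  assumes "(x, y) \<in> adjoint_op A"
  shows "(r *\<^sub>R x, r *\<^sub>R y) \<in> adjoint_op A"
  using assms by (fastforce simp: adjoint_op_def cinner_scaleC_right simp flip: scaleC_of_real)

text \<open>Two values at one point pair equally with every vector of the domain, so their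
  difference is orthogonal to a dense set and hence to itself.\<close>

lemma selfadjoint_op_single_valued:
  assumes "selfadjoint_op A"
  shows "single_valued A"
proof (rule single_valuedI)
  fix x y z assume xyz: "(x, y) \<in> A" "(x, z) \<in> A"
  have "inner u (y - z) = 0" if u: "u \<in> Domain A" for u
  proof -
    obtain w where w: "(u, w) \<in> A" using u by blast
    have "(x, y) \<in> adjoint_op A" "(x, z) \<in> adjoint_op A"
      using xyz assms unfolding selfadjoint_op_def by simp_all
    then have "cinner u y = cinner u z"
      using w unfolding adjoint_op_def by fastforce
    then have "inner u y = inner u z" by (simp add: inner_eq_Re_cinner)
    then show ?thesis by (simp add: inner_diff_right)
  qed
  then have "closure (Domain A) \<subseteq> {u. inner u (y - z) = 0}"
    by (intro closure_minimal closed_Collect_eq continuous_intros) auto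
  then have "inner (y - z) (y - z) = 0"
    using assms unfolding selfadjoint_op_def by blast
  then show "y = z" by simp
qed

lemma op_app_eq: "single_valued A \<Longrightarrow> (x, y) \<in> A \<Longrightarrow> A\<langle>x\<rangle> = y"
  unfolding op_app_def by (rule the_equality) (auto dest: single_valuedD)

lemma maps_into_op_app:
  assumes "single_valued A" "maps_into A D" "x \<in> D"
  shows "A\<langle>x\<rangle> \<in> D" "(x, A\<langle>x\<rangle>) \<in> A"
  using assms op_app_eq unfolding maps_into_def by metis+

section \<open>The operator exponential\<close>

lemma
  assumes "resolution_of_identity E"
  shows stieltjes_sum_add: "stieltjes_sum E f n m (x + y) = stieltjes_sum E f n m x + stieltjes_sum E f n m y"
    and stieltjes_sum_scaleC: "stieltjes_sum E f n m (c *\<^sub>C x) = c *\<^sub>C stieltjes_sum E f n m x"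
proof -
  have E: "E t (x + y) = E t x + E t y" "E t (c *\<^sub>C x) = c *\<^sub>C E t x" for t
    using assms unfolding resolution_of_identity_def by blast+
  show "stieltjes_sum E f n m (x + y) = stieltjes_sum E f n m x + stieltjes_sum E f n m y"
    unfolding stieltjes_sum_def E by (simp add: algebra_simps flip: sum.distrib)
  show "stieltjes_sum E f n m (c *\<^sub>C x) = c *\<^sub>C stieltjes_sum E f n m x"
    unfolding stieltjes_sum_def E scaleC_sum_right
    by (simp add: scaleC_diff_right scaleC_scaleC mult.commute flip: scaleC_of_real)
qed

lemma spectral_integral_add:
  assumes "resolution_of_identity E"
    and "(x, y) \<in> spectral_integral E f" "(x', y') \<in> spectral_integral E f"
  shows "(x + x', y + y') \<in> spectral_integral E f"
proof -
  obtain v v' where "\<And>n. (\<lambda>m. stieltjes_sum E f n m x) \<longlonglongrightarrow> v n" "v \<longlonglongrightarrow> y"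
      "\<And>n. (\<lambda>m. stieltjes_sum E f n m x') \<longlonglongrightarrow> v' n" "v' \<longlonglongrightarrow> y'"
    using assms(2,3) unfolding spectral_integral_def by blast
  then show ?thesis unfolding spectral_integral_def
    by (auto intro!: exI[of _ "\<lambda>n. v n + v' n"] tendsto_add simp: stieltjes_sum_add[OF assms(1)])
qed

lemma spectral_integral_scaleC:
  assumes "resolution_of_identity E" and "(x, y) \<in> spectral_integral E f"
  shows "(c *\<^sub>C x, c *\<^sub>C y) \<in> spectral_integral E f"
proof -
  obtain v where "\<And>n. (\<lambda>m. stieltjes_sum E f n m x) \<longlonglongrightarrow> v n" "v \<longlonglongrightarrow> y"
    using assms(2) unfolding spectral_integral_def by blast
  then show ?thesis unfolding spectral_integral_def
    by (auto intro!: exI[of _ "\<lambda>n. c *\<^sub>C v n"] tendsto_scaleC simp: stieltjes_sum_scaleC[OF assms(1)])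
qed

lemma spectral_integral_single_valued: "single_valued (spectral_integral E f)"
proof (rule single_valuedI)
  fix x y z assume "(x, y) \<in> spectral_integral E f" "(x, z) \<in> spectral_integral E f"
  then obtain v v' where v: "\<And>n. (\<lambda>m. stieltjes_sum E f n m x) \<longlonglongrightarrow> v n" "v \<longlonglongrightarrow> y"
      and v': "\<And>n. (\<lambda>m. stieltjes_sum E f n m x) \<longlonglongrightarrow> v' n" "v' \<longlonglongrightarrow> z"
    unfolding spectral_integral_def by blast
  have "v = v'" using v(1) v'(1) LIMSEQ_unique by blast
  then show "y = z" using v(2) v'(2) LIMSEQ_unique by blast
qed

text \<open>Each \<open>E r\<close> is a symmetric idempotent, hence a contraction whose quadratic
  form at \<open>x\<close> is the squared norm of \<open>E r x\<close>. Since
  \<open>E s x = E s (E t x)\<close>, contractivity gives the comparison.\<close>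

lemma resolution_of_identity_mono:
  assumes E: "resolution_of_identity E" and "s \<le> t"
  shows "inner x (E s x) \<le> inner x (E t x)"
proof -
  have sym: "inner (E r y) z = inner y (E r z)" and le: "E s (E t y) = E s y"
    and idem: "E r (E r y) = E r y" for r y z
    using E \<open>s \<le> t\<close> unfolding resolution_of_identity_def inner_eq_Re_cinner by auto
  have sq: "inner y (E r y) = (norm (E r y))\<^sup>2" for r y
    using sym[of r y "E r y"] by (simp add: idem power2_norm_eq_inner)
  have contr: "norm (E r y) \<le> norm y" for r y
  proof (cases "E r y = 0")
    case False
    have "norm (E r y) * norm (E r y) \<le> norm y * norm (E r y)"
      using sq[of y r] norm_cauchy_schwarz[of y "E r y"] by (simp add: power2_eq_square)
    then show ?thesis using False by simp
  qed simp
  have "norm (E s x) \<le> norm (E t x)"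
    using contr[of s "E t x"] by (simp add: le)
  then show ?thesis by (simp add: sq power_mono)
qed

lemma sum_telescope_int:
  fixes f :: "int \<Rightarrow> 'a::ab_group_add"
  assumes "a \<le> b"
  shows "(\<Sum>k\<in>{a..<b}. f (k + 1) - f k) = f b - f a"
  using assms
proof (induction b rule: int_ge_induct)
  case (step b)
  then have "{a..<b + 1} = insert b {a..<b}" by auto
  then show ?case using step by (simp add: algebra_simps)
qed simp

text \<open>Paired with \<open>x\<close>, the integral becomes that of a strictly positive function
  against the spectral measure of \<open>x\<close>. It vanishes only if this measure does, and the
  total mass is \<open>inner x x\<close>.\<close>

lemma spectral_integral_exp_kernel:
  assumes E: "resolution_of_identity E" and x: "(x, 0) \<in> spectral_integral E exp"
  shows "x = 0"
proof -
  \<comment> \<open>The distribution function of the spectral measure of \<open>x\<close>.\<close>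
  define F where "F t = inner x (E t x)" for t
  have mono: "F s \<le> F t" if "s \<le> t" for s t
    using resolution_of_identity_mono[OF E that] by (simp add: F_def)
  have lims: "(F \<longlongrightarrow> 0) at_bot" "(F \<longlongrightarrow> inner x x) at_top"
    using E tendsto_inner[OF tendsto_const[of x]] unfolding F_def resolution_of_identity_def
    by (metis inner_zero_right, blast)
  obtain v where v: "\<And>n. (\<lambda>m. stieltjes_sum E exp n m x) \<longlonglongrightarrow> v n" "v \<longlonglongrightarrow> 0"
    using x unfolding spectral_integral_def by blast
  \<comment> \<open>All increments of \<open>F\<close> are nonnegative, so cells outside
    \<open>(-N, N]\<close> may be dropped. On the others the left mesh point is at least
    \<open>-N\<close>. The bound is uniform in the mesh and in \<open>n\<close>.\<close>
  have sum_bound: "exp (- real N) * (F N - F (- real N)) \<le> inner x (stieltjes_sum E exp n m x)"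
    if "N \<le> n" for N n m
  proof -
    define d where "d k = F (of_int (k + 1) / Suc m) - F (of_int k / Suc m)" for k
    have d: "0 \<le> d k" for k
      unfolding d_def using mono by (simp add: divide_right_mono)
    have le: "int N * int (Suc m) \<le> int n * int (Suc m)" using that by (simp add: mult_right_mono)
    have "(\<Sum>k\<in>{- (int N * int (Suc m)) ..< int N * int (Suc m)}. d k)
        = F (of_int (int N * int (Suc m)) / Suc m) - F (of_int (- (int N * int (Suc m))) / Suc m)"
      unfolding d_def by (rule sum_telescope_int) (simp add: order_trans[of _ 0])
    then have "exp (- real N) * (F N - F (- real N))
        = exp (- real N) * (\<Sum>k\<in>{- (int N * int (Suc m)) ..< int N * int (Suc m)}. d k)"
      by simp
    also have "\<dots> = (\<Sum>k\<in>{- (int N * int (Suc m)) ..< int N * int (Suc m)}. exp (- real N) * d k)"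
      by (rule sum_distrib_left)
    also have "\<dots> \<le> (\<Sum>k\<in>{- (int N * int (Suc m)) ..< int N * int (Suc m)}. exp (of_int k / Suc m) * d k)"
    proof (intro sum_mono mult_right_mono d)
      fix k assume "k \<in> {- (int N * int (Suc m)) ..< int N * int (Suc m)}"
      then have "real_of_int (- (int N * int (Suc m))) \<le> real_of_int k"
        by (subst of_int_le_iff) simp
      then have "- real N \<le> of_int k / Suc m" by (simp add: field_simps)
      then show "exp (- real N) \<le> exp (of_int k / Suc m)" by simp
    qed
    also have "\<dots> \<le> (\<Sum>k\<in>{- (int n * int (Suc m)) ..< int n * int (Suc m)}. exp (of_int k / Suc m) * d k)"
      using le by (intro sum_mono2 mult_nonneg_nonneg d) auto
    also have "\<dots> = inner x (stieltjes_sum E exp n m x)"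
      unfolding stieltjes_sum_def d_def F_def
      by (simp add: inner_sum_right inner_diff_right)
    finally show ?thesis .
  qed
  \<comment> \<open>The limit is taken first in \<open>m\<close> and then in \<open>n\<close>, with
    \<open>N\<close> fixed; the positive factor \<open>exp (- real N)\<close> then cancels.\<close>
  have "F N \<le> F (- real N)" for N :: nat
  proof -
    have "exp (- real N) * (F N - F (- real N)) \<le> inner x (v n)" if "N \<le> n" for n
    proof (rule LIMSEQ_le_const)
      show "(\<lambda>m. inner x (stieltjes_sum E exp n m x)) \<longlonglongrightarrow> inner x (v n)"
        by (intro tendsto_intros v)
    qed (use sum_bound[OF that] in blast)
    moreover have "(\<lambda>n. inner x (v n)) \<longlonglongrightarrow> inner x 0"
      by (intro tendsto_intros v)
    ultimately have "exp (- real N) * (F N - F (- real N)) \<le> inner x 0"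
      by (intro LIMSEQ_le_const) auto
    then show ?thesis by (simp add: mult_le_0_iff)
  qed
  moreover have "(\<lambda>N. F (real N)) \<longlonglongrightarrow> inner x x"
    using lims(2) filterlim_real_sequentially by (rule filterlim_compose)
  moreover have "(\<lambda>N. F (- real N)) \<longlonglongrightarrow> 0"
    by (rule filterlim_compose[OF lims(1)])
      (simp add: filterlim_uminus_at_bot filterlim_real_sequentially)
  ultimately have "inner x x \<le> 0" by (intro LIMSEQ_le) auto
  then show "x = 0" using inner_ge_zero[of x] by (simp add: order_antisym)
qed

section \<open>Weyl relations on the invariant domain\<close>

context exponentiated_triple
begin

abbreviation L where "L \<equiv> lin_comb X Y Z D"

abbreviation W where "W x y z \<phi> \<equiv> (ex x y z)\<langle>\<phi>\<rangle>"

lemma D_add: "\<phi> \<in> D \<Longrightarrow> \<psi> \<in> D \<Longrightarrow> \<phi> + \<psi> \<in> D"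
  and D_scaleC: "\<phi> \<in> D \<Longrightarrow> c *\<^sub>C \<phi> \<in> D"
  using domain(1) unfolding csubspace_def by auto

lemma D_scaleR: "\<phi> \<in> D \<Longrightarrow> r *\<^sub>R \<phi> \<in> D"
  using D_scaleC[of \<phi> "of_real r"] by (simp add: scaleC_of_real)

text \<open>Linearity of the relation \<open>adjoint_op A = A\<close> becomes linearity of
  \<open>op_app\<close> because \<open>A\<close> is single-valued and has values on all of
  \<open>D\<close>.\<close>

lemma generator_linear:
  assumes "selfadjoint_op A" "maps_into A D" "\<phi> \<in> D"
  shows "A\<langle>\<phi>\<rangle> \<in> D"
    and "\<psi> \<in> D \<Longrightarrow> A\<langle>\<phi> + \<psi>\<rangle> = A\<langle>\<phi>\<rangle> + A\<langle>\<psi>\<rangle>"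
    and "A\<langle>r *\<^sub>R \<phi>\<rangle> = r *\<^sub>R A\<langle>\<phi>\<rangle>"
proof -
  note sv = selfadjoint_op_single_valued[OF assms(1)]
  note app = maps_into_op_app[OF sv assms(2)]
  have adj: "adjoint_op A = A" using assms(1) unfolding selfadjoint_op_def by simp
  show "A\<langle>\<phi>\<rangle> \<in> D" by (rule app assms)+
  show "A\<langle>\<phi> + \<psi>\<rangle> = A\<langle>\<phi>\<rangle> + A\<langle>\<psi>\<rangle>" if "\<psi> \<in> D"
    using adjoint_op_add[of \<phi> _ A \<psi>] app[OF assms(3)] app[OF that] unfolding adj
    by (intro op_app_eq sv) blast
  show "A\<langle>r *\<^sub>R \<phi>\<rangle> = r *\<^sub>R A\<langle>\<phi>\<rangle>"
    using adjoint_op_scaleR[of \<phi> _ A r] app[OF assms(3)] unfolding adj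
    by (intro op_app_eq sv) blast
qed

lemmas X_linear = generator_linear[OF selfadjoint(1) invariant(1)]
lemmas Y_linear = generator_linear[OF selfadjoint(2) invariant(2)]
lemmas Z_linear = generator_linear[OF selfadjoint(3) invariant(3)]

text \<open>The closure is self-adjoint, hence single-valued, so it adds no second value at a vector
  of \<open>D\<close>.\<close>

lemma lin_comb_app:
  assumes "\<phi> \<in> D"
  shows "(L x y z)\<langle>\<phi>\<rangle> = x *\<^sub>R X\<langle>\<phi>\<rangle> + y *\<^sub>R Y\<langle>\<phi>\<rangle> + z *\<^sub>R Z\<langle>\<phi>\<rangle>"
proof (rule op_app_eq)
  show "single_valued (L x y z)"
    using selfadjoint_lin_comb by (rule selfadjoint_op_single_valued)
  show "(\<phi>, x *\<^sub>R X\<langle>\<phi>\<rangle> + y *\<^sub>R Y\<langle>\<phi>\<rangle> + z *\<^sub>R Z\<langle>\<phi>\<rangle>) \<in> L x y z"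
    unfolding lin_comb_def using assms by (intro subsetD[OF closure_subset]) blast
qed

text \<open>The triple product of the two coefficient vectors with \<open>(1, 1, 1)\<close>. It is
  invariant under cyclic shifts of the coordinates, and \<open>(1, 1, 1)\<close> spans its radical,
  which is why \<open>e^(X+Y+Z)\<close> is central.\<close>

definition \<sigma> :: "real \<Rightarrow> real \<Rightarrow> real \<Rightarrow> real \<Rightarrow> real \<Rightarrow> real \<Rightarrow> real" where
  "\<sigma> x y z x' y' z' = x * y' - y * x' + y * z' - z * y' + z * x' - x * z'"

lemma lin_comb_commutator:
  "scalar_commutator D (L x y z) (L x' y' z') (2 * pi * \<i> * hbar * \<sigma> x y z x' y' z')"
  unfolding scalar_commutator_def
proof
  fix \<phi> assume \<phi>: "\<phi> \<in> D"
  let ?c = "2 * pi * \<i> * hbar :: complex"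
  \<comment> \<open>The commutators are oriented as rewrite rules that reverse \<open>XY\<close>,
    \<open>YZ\<close> and \<open>ZX\<close>, so both double products reach one normal order.\<close>
  have XY: "X\<langle>Y\<langle>\<phi>\<rangle>\<rangle> = Y\<langle>X\<langle>\<phi>\<rangle>\<rangle> + ?c *\<^sub>C \<phi>"
    and YZ: "Y\<langle>Z\<langle>\<phi>\<rangle>\<rangle> = Z\<langle>Y\<langle>\<phi>\<rangle>\<rangle> + ?c *\<^sub>C \<phi>"
    and ZX: "Z\<langle>X\<langle>\<phi>\<rangle>\<rangle> = X\<langle>Z\<langle>\<phi>\<rangle>\<rangle> + ?c *\<^sub>C \<phi>"
    using commutators \<phi> unfolding scalar_commutator_def by (auto simp: algebra_simps)
  \<comment> \<open>With the real factor split off, the final comparison is algebra with real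
    scalars.\<close>
  have "(?c * \<sigma> x y z x' y' z') *\<^sub>C \<phi> = \<sigma> x y z x' y' z' *\<^sub>R ?c *\<^sub>C \<phi>"
    by (simp add: scaleC_scaleC mult_ac flip: scaleC_of_real)
  then show "(L x y z)\<langle>(L x' y' z')\<langle>\<phi>\<rangle>\<rangle> - (L x' y' z')\<langle>(L x y z)\<langle>\<phi>\<rangle>\<rangle> = (?c * \<sigma> x y z x' y' z') *\<^sub>C \<phi>"
    using \<phi>
    by (simp add: lin_comb_app X_linear Y_linear Z_linear D_add D_scaleR XY YZ ZX \<sigma>_def)
       (simp add: algebra_simps)
qed

section \<open>Linearity and composition of the exponentials on \<open>D\<close>\<close>

lemma exponential_single_valued: "single_valued (ex x y z)"
  using exponential[of x y z] spectral_integral_single_valued unfolding is_exponential_def by metis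

lemmas W_app = maps_into_op_app[OF exponential_single_valued invariant_exponential]

lemma W_in_D: "\<phi> \<in> D \<Longrightarrow> W x y z \<phi> \<in> D" by (rule W_app)

lemma W_add:
  assumes "\<phi> \<in> D" "\<psi> \<in> D"
  shows "W x y z (\<phi> + \<psi>) = W x y z \<phi> + W x y z \<psi>"
proof (rule op_app_eq[OF exponential_single_valued])
  show "(\<phi> + \<psi>, W x y z \<phi> + W x y z \<psi>) \<in> ex x y z"
    using exponential[of x y z] W_app[OF assms(1), of x y z] W_app[OF assms(2), of x y z]
    unfolding is_exponential_def by (metis spectral_integral_add)
qed

lemma W_scaleC:
  assumes "\<phi> \<in> D"
  shows "W x y z (c *\<^sub>C \<phi>) = c *\<^sub>C W x y z \<phi>"
proof (rule op_app_eq[OF exponential_single_valued])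
  show "(c *\<^sub>C \<phi>, c *\<^sub>C W x y z \<phi>) \<in> ex x y z"
    using exponential[of x y z] W_app[OF assms, of x y z]
    unfolding is_exponential_def by (metis spectral_integral_scaleC)
qed

text \<open>\<open>Q s\<close> is \<open>q\<^sup>s\<close> without a choice of branch.\<close>

definition Q :: "real \<Rightarrow> complex" where
  "Q s = exp (\<i> * pi * hbar * s)"

lemma Q_mult: "Q s * Q t = Q (s + t)" "Q s * (Q t * c) = Q (s + t) * c"
  by (simp_all add: Q_def exp_add algebra_simps)

lemma Q_zero: "Q 0 = 1"
  by (simp add: Q_def)

text \<open>Half of the commutator scalar is \<open>\<i> * pi * hbar\<close> times the form
  \<open>\<sigma>\<close>, so the phase is a power of \<open>q\<close>.\<close>

lemma W_mult:
  assumes "\<phi> \<in> D"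
  shows "W x y z (W x' y' z' \<phi>) = Q (\<sigma> x y z x' y' z') *\<^sub>C W (x + x') (y + y') (z + z') \<phi>"
  using exponential_product[OF lin_comb_commutator assms] by (simp add: Q_def mult_ac)

text \<open>Products with opposite exponents end in \<open>W 0 0 0\<close>; this lemma turns them
  into the scalar terms of the relations.\<close>

lemma W_zero:
  assumes "\<phi> \<in> D"
  shows "W 0 0 0 \<phi> = \<phi>"
proof -
  define \<psi> where "\<psi> = W 0 0 0 \<phi> + (-1) *\<^sub>C \<phi>"
  have "\<psi> \<in> D" unfolding \<psi>_def by (intro D_add D_scaleC W_in_D assms)
  have "W 0 0 0 \<psi> = 0"
    \<comment> \<open>\<open>W 0 0 0\<close> is idempotent, and exponentials are injective.\<close>
    using assms unfolding \<psi>_def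
    by (simp add: W_add W_scaleC W_in_D D_scaleC W_mult \<sigma>_def Q_zero)
       (simp add: scaleC_minus_one)
  then have "(\<psi>, 0) \<in> ex 0 0 0" using W_app(2)[OF \<open>\<psi> \<in> D\<close>, of 0 0 0] by simp
  then have "\<psi> = 0"
    using exponential[of 0 0 0] spectral_integral_exp_kernel unfolding is_exponential_def by blast
  then show ?thesis by (simp add: \<psi>_def scaleC_minus_one)
qed

section \<open>The geodesic functions\<close>

text \<open>The summands follow the order \<open>c1\<close>, \<open>b1\<close>,
  \<open>\<omega>0 a1\<close>, with the entries written out as Weyl operators.\<close>

definition G_XZ :: "complex \<Rightarrow> complex \<Rightarrow> 'h \<Rightarrow> 'h" where
  "G_XZ w0 w1 \<phi> = W (-1) 0 (-1) \<phi> + W 1 0 (-1) \<phi> + W 1 0 1 \<phi> + w1 *\<^sub>C W 1 0 0 \<phi> + w0 *\<^sub>C W 0 0 (-1) \<phi>"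

definition G_XY :: "complex \<Rightarrow> complex \<Rightarrow> 'h \<Rightarrow> 'h" where
  "G_XY w0 w2 \<phi> = W (-1) (-1) 0 \<phi> + W (-1) 1 0 \<phi> + W 1 1 0 \<phi> + w2 *\<^sub>C W (-1) 0 0 \<phi> + w0 *\<^sub>C W 0 1 0 \<phi>"

text \<open>Cancellation in the defining expressions leaves five Weyl operators in \<open>G\<^sub>Y\<^sub>Z\<close>, while the
  central elements collapse to \<open>K\<^sub>1 = e\<^sup>-\<^sup>X\<^sup>-\<^sup>Y\<^sup>-\<^sup>Z\<close> and \<open>K\<^sub>2 = e\<^sup>X\<^sup>+\<^sup>Y\<^sup>+\<^sup>Z\<close>.\<close>

definition G_YZ :: "complex \<Rightarrow> complex \<Rightarrow> 'h \<Rightarrow> 'h" where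
  "G_YZ w1 w2 \<phi> = W 0 (-1) (-1) \<phi> + W 0 (-1) 1 \<phi> + W 0 1 1 \<phi> + w2 *\<^sub>C W 0 0 1 \<phi> + w1 *\<^sub>C W 0 (-1) 0 \<phi>"

definition casimir :: "'h \<Rightarrow> 'h" where
  "casimir \<phi> = W (-1) (-1) (-1) \<phi> + W 1 1 1 \<phi>"

text \<open>As rewrite rules these reduce any composite at a vector of \<open>D\<close> to a
  combination of vectors \<open>W x y z \<phi>\<close>; \<open>Q_mult\<close> then merges the
  phases.\<close>

lemmas W_simps = W_in_D W_add D_add D_scaleC W_scaleC W_mult W_zero \<sigma>_def Q_zero
  scaleC_add_right scaleC_diff_right scaleC_scaleC scaleC_add_left scaleC_diff_left

text \<open>Among the 25 pairs of Weyl operators, those with \<open>\<sigma> = -1\<close> drop out.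
  Pairs with \<open>\<sigma> = 1\<close> give the \<open>G_YZ\<close> terms, and those with
  \<open>\<sigma> = 0\<close> the scalar and Casimir terms. The surplus of these is cancelled by the
  pairs with \<open>\<sigma> = -3\<close> and \<open>\<sigma> = -2\<close> respectively.\<close>

lemma G_XY_G_XZ:
  assumes "\<phi> \<in> D"
  shows "Q 1 *\<^sub>C G_XY w0 w2 (G_XZ w0 w1 \<phi>) - Q (-1) *\<^sub>C G_XZ w0 w1 (G_XY w0 w2 \<phi>)
    = (Q 2 - Q (-2)) *\<^sub>C G_YZ w1 w2 \<phi> + (Q 1 - Q (-1)) *\<^sub>C ((w1 * w2) *\<^sub>C \<phi> + w0 *\<^sub>C casimir \<phi>)"
  using assms by (simp add: G_XY_def G_XZ_def G_YZ_def casimir_def W_simps)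
    (simp add: Q_mult Q_zero scaleC_diff_left algebra_simps)

text \<open>This relation and the next are the images of \<open>G_XY_G_XZ\<close> under the cyclic
  shifts of X, Y, Z, which also permute the parameters cyclically. The same cancellations therefore
  occur.\<close>

lemma G_XZ_G_YZ:
  assumes "\<phi> \<in> D"
  shows "Q 1 *\<^sub>C G_XZ w0 w1 (G_YZ w1 w2 \<phi>) - Q (-1) *\<^sub>C G_YZ w1 w2 (G_XZ w0 w1 \<phi>)
    = (Q 2 - Q (-2)) *\<^sub>C G_XY w0 w2 \<phi> + (Q 1 - Q (-1)) *\<^sub>C ((w2 * w0) *\<^sub>C \<phi> + w1 *\<^sub>C casimir \<phi>)"
  using assms by (simp add: G_XY_def G_XZ_def G_YZ_def casimir_def W_simps)
    (simp add: Q_mult Q_zero scaleC_diff_left algebra_simps)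

lemma G_YZ_G_XY:
  assumes "\<phi> \<in> D"
  shows "Q 1 *\<^sub>C G_YZ w1 w2 (G_XY w0 w2 \<phi>) - Q (-1) *\<^sub>C G_XY w0 w2 (G_YZ w1 w2 \<phi>)
    = (Q 2 - Q (-2)) *\<^sub>C G_XZ w0 w1 \<phi> + (Q 1 - Q (-1)) *\<^sub>C ((w0 * w1) *\<^sub>C \<phi> + w2 *\<^sub>C casimir \<phi>)"
  using assms by (simp add: G_XY_def G_XZ_def G_YZ_def casimir_def W_simps)
    (simp add: Q_mult Q_zero scaleC_diff_left algebra_simps)

text \<open>The normal forms of \<open>GYZ\<close> and \<open>\<omega>3\<close> are available only
  on \<open>D\<close>, so an inner factor must return a vector of \<open>D\<close>.\<close>

lemma G_XZ_in_D: "\<phi> \<in> D \<Longrightarrow> G_XZ w0 w1 \<phi> \<in> D"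
  and G_XY_in_D: "\<phi> \<in> D \<Longrightarrow> G_XY w0 w2 \<phi> \<in> D"
  by (simp_all add: G_XZ_def G_XY_def D_add D_scaleC W_in_D)

end

section \<open>From the monodromy entries to the Weyl normal forms\<close>

theorem mainTheorem12:
  fixes hbar \<omega>0 \<omega>1 \<omega>2 :: real
    and q :: complex
    and X Y Z :: "'h::complex_hilbert rel"
    and D :: "'h set"
    and ex :: "real \<Rightarrow> real \<Rightarrow> real \<Rightarrow> 'h rel"
    and e :: "real \<Rightarrow> real \<Rightarrow> real \<Rightarrow> 'h \<Rightarrow> 'h"
    and a1 b1 c1 a2 b2 c2 K1 K2 \<omega>3 GXZ GXY GYZ :: "'h \<Rightarrow> 'h"
  assumes hbar: "hbar > 0"
    and q: "q = exp (\<i> * pi * hbar)"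
    and triple: "exponentiated_triple hbar X Y Z D ex"
    and e: "\<And>x y z. e x y z = op_app (ex x y z)"
    and a1: "a1 = e 0 0 (-1)"
    and b1: "b1 = e 1 0 (-1) + e 1 0 1 + \<omega>1 \<odot> e 1 0 0"
    and c1: "c1 = e (-1) 0 (-1)"
    and a2: "a2 = e 0 1 0"
    and b2: "b2 = e 1 1 0"
    and c2: "c2 = e (-1) (-1) 0 + e (-1) 1 0 + \<omega>2 \<odot> e (-1) 0 0"
    and K1: "K1 = a1 \<star> c2 - q^2 \<odot> (c1 \<star> a2) - (q * \<omega>2) \<odot> c1"
    and K2: "K2 = a2 \<star> b1 - (1/q^2) \<odot> (b2 \<star> a1) - (1/q * \<omega>1) \<odot> b2"
    and \<omega>3: "\<omega>3 = K1 + K2"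
    and GXZ: "GXZ = c1 + b1 + \<omega>0 \<odot> a1"
    and GXY: "GXY = c2 + b2 + \<omega>0 \<odot> a2"
    and GYZ: "GYZ = q \<odot> (b1 \<star> c2) - q^3 \<odot> (a1 \<star> a2)
                  - q^2 \<odot> (\<omega>1 \<odot> a2 + \<omega>2 \<odot> a1) - (q * \<omega>1 * \<omega>2) \<odot> id"
  shows "(\<forall>\<phi>\<in>D. (q \<odot> (GXY \<star> GXZ) - (1/q) \<odot> (GXZ \<star> GXY)) \<phi>
               = ((q^2 - 1/q^2) \<odot> GYZ + (q - 1/q) \<odot> ((\<omega>1 * \<omega>2) \<odot> id + \<omega>0 \<odot> \<omega>3)) \<phi>)
       \<and> (\<forall>\<phi>\<in>D. (q \<odot> (GXZ \<star> GYZ) - (1/q) \<odot> (GYZ \<star> GXZ)) \<phi>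
               = ((q^2 - 1/q^2) \<odot> GXY + (q - 1/q) \<odot> ((\<omega>2 * \<omega>0) \<odot> id + \<omega>1 \<odot> \<omega>3)) \<phi>)
       \<and> (\<forall>\<phi>\<in>D. (q \<odot> (GYZ \<star> GXY) - (1/q) \<odot> (GXY \<star> GYZ)) \<phi>
               = ((q^2 - 1/q^2) \<odot> GXZ + (q - 1/q) \<odot> ((\<omega>0 * \<omega>1) \<odot> id + \<omega>2 \<odot> \<omega>3)) \<phi>)"
proof -
  interpret exponentiated_triple hbar X Y Z D ex by (rule triple)
  have "q = Q 1" by (simp add: q Q_def)
  moreover have "1 / Q 1 = Q (-1)" "1 / Q 2 = Q (-2)"
    by (simp_all add: Q_def exp_minus inverse_eq_divide)
  ultimately have Q: "q = Q 1" "(Q 1)^2 = Q 2" "(Q 1)^3 = Q 3" "1 / Q 1 = Q (-1)" "1 / Q 2 = Q (-2)"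
    by (simp_all add: power2_eq_square power3_eq_cube Q_mult)
  \<comment> \<open>Only sums of exponentials occur here, so the equations hold at every
    vector.\<close>
  have XZ: "GXZ \<phi> = G_XZ \<omega>0 \<omega>1 \<phi>" and XY: "GXY \<phi> = G_XY \<omega>0 \<omega>2 \<phi>" for \<phi>
    by (simp_all add: GXZ GXY c1 b1 a1 a2 b2 c2 e G_XZ_def G_XY_def op_scale_def algebra_simps)
  \<comment> \<open>Of the nine products in \<open>b1 \<star> c2\<close>, four cancel against the
    subtracted terms of \<open>GYZ\<close>, the one with \<open>\<omega>1 * \<omega>2\<close> by
    means of \<open>W_zero\<close>. The products call for the Weyl relations, hence for a vector of
    \<open>D\<close>.\<close>
  have YZ: "GYZ \<phi> = G_YZ \<omega>1 \<omega>2 \<phi>" and K: "\<omega>3 \<phi> = casimir \<phi>" if "\<phi> \<in> D" for \<phi>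
    using that
    by (simp_all add: GYZ \<omega>3 K1 K2 Q c1 b1 a1 a2 b2 c2 e G_YZ_def casimir_def op_scale_def W_simps)
       (simp_all add: Q_mult Q_zero scaleC_diff_left algebra_simps)
  show ?thesis
    using G_XY_G_XZ[of _ \<omega>0 \<omega>2 \<omega>1] G_XZ_G_YZ[of _ \<omega>0 \<omega>1 \<omega>2] G_YZ_G_XY[of _ \<omega>1 \<omega>2 \<omega>0]
    by (simp add: op_scale_def Q XZ XY YZ K G_XZ_in_D G_XY_in_D)
qed

end
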